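(* Let $N\ge 2$ and $K\ge 1$ be integers, and let $\{A_{ij}\}_{1\le i<j\le N}$ be independent random variables with $A_{ij}\sim\operatorname{Bernoulli}(P_{ij})$, where $P_{ij}\in[0,1]$ are arbitrary. For each class assignment $z\in\{1,\dots,K\}^N$, let $\hat\theta=\hat\theta^{(z)}$ be the blockwise sample-proportion matrix (which maximizes the $K$-class blockmodel log-likelihood $L(A;z,\cdot)$) and let $\bar\theta=\bar\theta^{(z)}$ be its expectation, as defined in the context. Then for every $0<\delta<1$, with probability at least $1-\delta$, $$\max_{z\in\{1,\dots,K\}^N}\Big\{\sum_{1\le a\le b\le K} n_{ab}\, D\big(\hat\theta_{ab}\,\|\,\bar\theta_{ab}\big)\Big\} < N\log K+(K^2+K)\log\Big(\frac NK+1\Big)+\log\frac1\delta ,$$ where $n_{ab}$, $\hat\theta_{ab}$, $\bar\theta_{ab}$ all depend on $z$.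
   Context: For $z\in\{1,\dots,K\}^N$, $N_a=\#\{i: z_i=a\}$; $n_{ab}=N_aN_b$ if $a\ne b$ and $n_{aa}=\binom{N_a}{2}$ (the number of unordered pairs of distinct nodes with classes $a$ and $b$). The symmetric $K\times K$ matrices $\hat\theta^{(z)}$, $\bar\theta^{(z)}$ are defined, for $a\le b$ with $n_{ab}\neq 0$, by $$\hat\theta^{(z)}_{ab}=\frac1{n_{ab}}\sum_{i<j}A_{ij}\,1\{\{z_i,z_j\}=\{a,b\}\},\qquad \bar\theta^{(z)}_{ab}=\frac1{n_{ab}}\sum_{i<j}P_{ij}\,1\{\{z_i,z_j\}=\{a,b\}\}.$$ Terms with $n_{ab}=0$ are taken to be $0$ in the sum. The blockmodel log-likelihood is $L(A;z,\theta)=\sum_{i<j}\{A_{ij}\log\theta_{z_iz_j}+(1-A_{ij})\log(1-\theta_{z_iz_j})\}$ for symmetric $\theta\in[0,1]^{K\times K}$. $D(p\,\|\,p')=p\log\frac{p}{p'}+(1-p)\log\frac{1-p}{1-p'}$ is the Kullback–Leibler divergence between $\operatorname{Bernoulli}(p)$ and $\operatorname{Bernoulli}(p')$, with the usual conventions ($0\log 0=0$, $0\log(0/0)=0$, value $+\infty$ if $\operatorname{Bernoulli}(p)$ is not absolutely continuous with respect to $\operatorname{Bernoulli}(p')$). Logarithms are natural. *)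

theory Defs
  imports "HOL-Probability.Probability"
begin

text \<open>Nodes are \<open>{1..N}\<close>, classes are \<open>{1..K}\<close>. Class assignments are extensional functions, so that
  there are exactly \<open>K ^ N\<close> of them and a maximum over them is a maximum over a finite set.\<close>

definition assignments :: "nat \<Rightarrow> nat \<Rightarrow> (nat \<Rightarrow> nat) set" where
  "assignments N K = {1..N} \<rightarrow>\<^sub>E {1..K}"

definition node_pairs :: "nat \<Rightarrow> (nat \<times> nat) set" where
  "node_pairs N = {(i, j). 1 \<le> i \<and> i < j \<and> j \<le> N}"

definition class_pairs :: "nat \<Rightarrow> (nat \<times> nat) set" where
  "class_pairs K = {(a, b). 1 \<le> a \<and> a \<le> b \<and> b \<le> K}"

definition class_size :: "nat \<Rightarrow> (nat \<Rightarrow> nat) \<Rightarrow> nat \<Rightarrow> nat" where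
  "class_size N z a = card {i \<in> {1..N}. z i = a}"

definition block_size :: "nat \<Rightarrow> (nat \<Rightarrow> nat) \<Rightarrow> nat \<Rightarrow> nat \<Rightarrow> nat" where
  "block_size N z a b =
     (if a \<noteq> b then class_size N z a * class_size N z b else class_size N z a choose 2)"

text \<open>The blockwise average of an edge-weight array \<open>W\<close>, of which only the entries \<open>W i j\<close> with
  \<open>i < j\<close> matter; it is symmetric in \<open>a\<close> and \<open>b\<close>, and \<open>0\<close> if the block is empty.\<close>

definition block_mean :: "nat \<Rightarrow> (nat \<Rightarrow> nat) \<Rightarrow> (nat \<Rightarrow> nat \<Rightarrow> real) \<Rightarrow> nat \<Rightarrow> nat \<Rightarrow> real" where
  "block_mean N z W a b =
     (\<Sum>(i, j)\<in>node_pairs N. W i j * of_bool ({z i, z j} = {a, b})) / real (block_size N z a b)"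

definition theta_hat :: "nat \<Rightarrow> (nat \<Rightarrow> nat \<Rightarrow> bool) \<Rightarrow> (nat \<Rightarrow> nat) \<Rightarrow> nat \<Rightarrow> nat \<Rightarrow> real" where
  "theta_hat N A z = block_mean N z (\<lambda>i j. of_bool (A i j))"

definition theta_bar :: "nat \<Rightarrow> (nat \<Rightarrow> nat \<Rightarrow> real) \<Rightarrow> (nat \<Rightarrow> nat) \<Rightarrow> nat \<Rightarrow> nat \<Rightarrow> real" where
  "theta_bar N P z = block_mean N z P"

text \<open>Extended-real versions of \<open>p * ln (p / q)\<close> and \<open>p * ln q\<close> for \<open>p, q \<ge> 0\<close> that implement
  \<open>0 * ln 0 = 0\<close>, \<open>0 * ln (0 / 0) = 0\<close>, \<open>p * ln (p / 0) = \<infinity>\<close> and \<open>p * ln 0 = - \<infinity>\<close> for \<open>p > 0\<close>.\<close>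

definition ln_ratio_term :: "real \<Rightarrow> real \<Rightarrow> ereal" where
  "ln_ratio_term p q = (if p = 0 then 0 else if q = 0 then \<infinity> else ereal (p * ln (p / q)))"

definition ln_term :: "real \<Rightarrow> real \<Rightarrow> ereal" where
  "ln_term p q = (if p = 0 then 0 else if q = 0 then - \<infinity> else ereal (p * ln q))"

definition bernoulli_KL :: "real \<Rightarrow> real \<Rightarrow> ereal" where
  "bernoulli_KL p q = ln_ratio_term p q + ln_ratio_term (1 - p) (1 - q)"

definition log_likelihood ::
    "nat \<Rightarrow> (nat \<Rightarrow> nat \<Rightarrow> bool) \<Rightarrow> (nat \<Rightarrow> nat) \<Rightarrow> (nat \<Rightarrow> nat \<Rightarrow> real) \<Rightarrow> ereal" where
  "log_likelihood N A z \<theta> =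
     (\<Sum>(i, j)\<in>node_pairs N. ln_term (of_bool (A i j)) (\<theta> (z i) (z j))
        + ln_term (1 - of_bool (A i j)) (1 - \<theta> (z i) (z j)))"

text \<open>Summands of empty blocks vanish because \<open>0 * x = 0\<close> for every extended real \<open>x\<close>.\<close>

definition block_divergence ::
    "nat \<Rightarrow> nat \<Rightarrow> (nat \<Rightarrow> nat \<Rightarrow> real) \<Rightarrow> (nat \<Rightarrow> nat \<Rightarrow> bool) \<Rightarrow> (nat \<Rightarrow> nat) \<Rightarrow> ereal" where
  "block_divergence N K P A z =
     (\<Sum>(a, b)\<in>class_pairs K. ereal (real (block_size N z a b))
        * bernoulli_KL (theta_hat N A z a b) (theta_bar N P z a b))"

lemma finite_node_pairs [simp]: "finite (node_pairs N)"
  by (rule finite_subset[of _ "{1..N} \<times> {1..N}"]) (auto simp: node_pairs_def)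

lemma bernoulli_KL_eq_KL_divergence:
  assumes p: "0 \<le> p" "p \<le> 1" and q: "0 \<le> q" "q \<le> 1"
    and ac: "q = 0 \<Longrightarrow> p = 0" "q = 1 \<Longrightarrow> p = 1"
  shows "bernoulli_KL p q =
    ereal (KL_divergence (exp 1) (measure_pmf (bernoulli_pmf q)) (measure_pmf (bernoulli_pmf p)))"
proof -
  interpret information_space "measure_pmf (bernoulli_pmf p)" "exp 1"
    by unfold_locales auto
  have sf: "sigma_finite_measure (count_space (UNIV :: bool set))"
    by (rule sigma_finite_measure_count_space_finite) simp
  have "KL_divergence (exp 1) (measure_pmf (bernoulli_pmf q)) (measure_pmf (bernoulli_pmf p))
     = KL_divergence (exp 1) (density (count_space UNIV) (pmf (bernoulli_pmf q)))
         (density (count_space UNIV) (pmf (bernoulli_pmf p)))"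
    by (metis measure_pmf_eq_density)
  also have "\<dots> = (\<integral>x. pmf (bernoulli_pmf p) x *
       log (exp 1) (pmf (bernoulli_pmf p) x / pmf (bernoulli_pmf q) x) \<partial>count_space UNIV)"
  proof (rule sigma_finite_measure.KL_density_density[OF sf])
    show "AE x in count_space UNIV. pmf (bernoulli_pmf q) x = 0 \<longrightarrow> pmf (bernoulli_pmf p) x = 0"
      using p q ac by (auto simp: AE_count_space all_bool_eq)
  qed (use p q in auto)
  also have "\<dots> = p * ln (p / q) + (1 - p) * ln ((1 - p) / (1 - q))"
    using p q by (simp add: lebesgue_integral_count_space_finite UNIV_bool log_def)
  finally show ?thesis
    using p q ac by (auto simp: bernoulli_KL_def ln_ratio_term_def)
qed

lemma expectation_theta_hat:
  assumes M: "prob_space M"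
    and P: "\<And>i j. (i, j) \<in> node_pairs N \<Longrightarrow> P i j \<in> {0..1}"
    and meas: "\<And>i j. (i, j) \<in> node_pairs N \<Longrightarrow> A i j \<in> measurable M (count_space UNIV)"
    and distr: "\<And>i j. (i, j) \<in> node_pairs N \<Longrightarrow>
          distr M (count_space UNIV) (A i j) = measure_pmf (bernoulli_pmf (P i j))"
  shows "(\<integral>\<omega>. theta_hat N (\<lambda>i j. A i j \<omega>) z a b \<partial>M) = theta_bar N P z a b"
proof -
  interpret prob_space M by fact
  have int: "integrable M (\<lambda>\<omega>. of_bool (A i j \<omega>) :: real)"
    and ex: "(\<integral>\<omega>. of_bool (A i j \<omega>) \<partial>M) = P i j" if "(i, j) \<in> node_pairs N" for i j
  proof -
    note m = meas[OF that]
    have b: "(\<lambda>\<omega>. of_bool (A i j \<omega>) :: real) \<in> borel_measurable M"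
      by (rule measurable_compose[OF m]) simp
    show "integrable M (\<lambda>\<omega>. of_bool (A i j \<omega>) :: real)"
      by (rule integrable_const_bound[where B = 1]) (use b in auto)
    have "(\<integral>\<omega>. of_bool (A i j \<omega>) \<partial>M) = (\<integral>x. of_bool x \<partial>distr M (count_space UNIV) (A i j) :: real)"
      by (rule integral_distr[OF m, symmetric]) simp
    also have "\<dots> = P i j"
      using P[OF that] by (simp add: distr[OF that])
    finally show "(\<integral>\<omega>. of_bool (A i j \<omega>) \<partial>M) = P i j" .
  qed
  have "(\<integral>\<omega>. (\<Sum>(i, j)\<in>node_pairs N. of_bool (A i j \<omega>) * of_bool ({z i, z j} = {a, b})) \<partial>M)
     = (\<Sum>(i, j)\<in>node_pairs N. P i j * of_bool ({z i, z j} = {a, b}) :: real)"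
    by (subst Bochner_Integration.integral_sum)
      (auto simp: int ex case_prod_beta intro!: sum.cong integrable_mult_left)
  then show ?thesis
    by (simp add: theta_hat_def theta_bar_def block_mean_def)
qed

lemma card_block:
  "card {(i, j) \<in> node_pairs N. {z i, z j} = {a, b}} = block_size N z a b"
proof (cases "a = b")
  case True
  let ?S = "{i \<in> {1..N}. z i = a}"
  have "bij_betw (\<lambda>(i, j). {i, j}) {(i, j) \<in> node_pairs N. {z i, z j} = {a, b}}
          {T. T \<subseteq> ?S \<and> card T = 2}"
  proof (rule bij_betw_imageI)
    show "inj_on (\<lambda>(i, j). {i, j}) {(i, j) \<in> node_pairs N. {z i, z j} = {a, b}}"
      by (auto simp: inj_on_def node_pairs_def doubleton_eq_iff)
    show "(\<lambda>(i, j). {i, j}) ` {(i, j) \<in> node_pairs N. {z i, z j} = {a, b}}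
          = {T. T \<subseteq> ?S \<and> card T = 2}" (is "?L = ?R")
    proof (intro equalityI subsetI)
      fix T assume "T \<in> ?L"
      then show "T \<in> ?R"
        using True by (auto simp: node_pairs_def doubleton_eq_iff)
    next
      fix T assume "T \<in> ?R"
      then obtain x y where T: "T = {x, y}" "x \<noteq> y" "x \<in> ?S" "y \<in> ?S"
        by (auto simp: card_2_iff)
      then have "T = (\<lambda>(i, j). {i, j}) (min x y, max x y)"
        by (auto simp: min_def max_def)
      moreover have "(min x y, max x y) \<in> {(i, j) \<in> node_pairs N. {z i, z j} = {a, b}}"
        using T True by (auto simp: node_pairs_def min_def max_def)
      ultimately show "T \<in> ?L" by (rule image_eqI)
    qed
  qed
  then show ?thesis
    using True by (simp add: bij_betw_same_card n_subsets block_size_def class_size_def)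
next
  case False
  let ?S = "\<lambda>a. {i \<in> {1..N}. z i = a}"
  have "bij_betw (\<lambda>(x, y). (min x y, max x y)) (?S a \<times> ?S b)
          {(i, j) \<in> node_pairs N. {z i, z j} = {a, b}}"
  proof (rule bij_betw_imageI)
    show "inj_on (\<lambda>(x, y). (min x y, max x y)) (?S a \<times> ?S b)"
      using False by (auto simp: inj_on_def min_def max_def split: if_splits)
    show "(\<lambda>(x, y). (min x y, max x y)) ` (?S a \<times> ?S b)
          = {(i, j) \<in> node_pairs N. {z i, z j} = {a, b}}" (is "?L = ?R")
    proof (intro equalityI subsetI)
      fix p assume "p \<in> ?L"
      then obtain x y where xy: "p = (min x y, max x y)" "x \<in> ?S a" "y \<in> ?S b" by auto
      then have "x \<noteq> y" using False by auto
      then show "p \<in> ?R" using xy by (auto simp: node_pairs_def min_def max_def)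
    next
      fix p assume "p \<in> ?R"
      then obtain i j where p: "p = (i, j)" "(i, j) \<in> node_pairs N" "{z i, z j} = {a, b}" by auto
      then consider "z i = a" "z j = b" | "z i = b" "z j = a" by (auto simp: doubleton_eq_iff)
      then show "p \<in> ?L"
      proof cases
        case 1
        then show ?thesis using p
          by (intro image_eqI[where x = "(i, j)"]) (auto simp: node_pairs_def)
      next
        case 2
        then show ?thesis using p
          by (intro image_eqI[where x = "(j, i)"]) (auto simp: node_pairs_def)
      qed
    qed
  qed
  from bij_betw_same_card[OF this] show ?thesis
    using False by (simp add: card_cartesian_product block_size_def class_size_def)
qed

lemma finite_class_pairs [simp]: "finite (class_pairs K)"
  by (rule finite_subset[of _ "{1..K} \<times> {1..K}"]) (auto simp: class_pairs_def)

lemma block_mean_commute: "block_mean N z W a b = block_mean N z W b a"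
  by (simp add: block_mean_def block_size_def insert_commute mult.commute)

lemma theta_hat_maximizes_log_likelihood:
  assumes z: "z \<in> assignments N K"
    and range: "\<And>a b. a \<in> {1..K} \<Longrightarrow> b \<in> {1..K} \<Longrightarrow> \<theta> a b \<in> {0..1}"
    and sym: "\<And>a b. a \<in> {1..K} \<Longrightarrow> b \<in> {1..K} \<Longrightarrow> \<theta> a b = \<theta> b a"
  shows "log_likelihood N A z \<theta> \<le> log_likelihood N A z (theta_hat N A z)"
proof -
  define h where "h = theta_hat N A z"
  define B where "B a b = {(i, j) \<in> node_pairs N. {z i, z j} = {a, b}}" for a b
  define s where "s a b = (\<Sum>(i, j)\<in>B a b. of_bool (A i j) :: real)" for a b
  define n where "n a b = real (card (B a b))" for a b
  define c where "c x a b = (if x then \<theta> a b / h a b - 1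
      else (1 - \<theta> a b) / (1 - h a b) - 1)" for x a b
  define t :: "(nat \<Rightarrow> nat \<Rightarrow> real) \<Rightarrow> nat \<times> nat \<Rightarrow> ereal" where
    "t \<phi> = (\<lambda>(i, j). ln_term (of_bool (A i j)) (\<phi> (z i) (z j))
        + ln_term (1 - of_bool (A i j)) (1 - \<phi> (z i) (z j)))" for \<phi>
  have finB [simp]: "finite (B a b)" for a b
    by (rule finite_subset[OF _ finite_node_pairs[of N]]) (auto simp: B_def)
  have h_eq: "h a b = s a b / n a b" for a b
  proof -
    have "(\<Sum>(i, j)\<in>node_pairs N. of_bool (A i j) * of_bool ({z i, z j} = {a, b})) = s a b"
      unfolding s_def
      by (rule sum.mono_neutral_cong_right) (auto simp: B_def)
    then show ?thesis
      by (simp add: h_def theta_hat_def block_mean_def n_def B_def card_block)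
  qed
  have n_s: "n a b - s a b = (\<Sum>(i, j)\<in>B a b. of_bool (\<not> A i j))" for a b
  proof -
    have "n a b = (\<Sum>(i, j)\<in>B a b. of_bool (A i j) + of_bool (\<not> A i j))"
    proof -
      have "(\<Sum>(i, j)\<in>B a b. of_bool (A i j) + of_bool (\<not> A i j) :: real) = (\<Sum>p\<in>B a b. 1)"
        by (rule sum.cong) auto
      then show ?thesis by (simp add: n_def)
    qed
    then show ?thesis by (simp add: s_def sum.distrib case_prod_beta)
  qed
  have s_nonneg: "0 \<le> s a b" "s a b \<le> n a b" for a b
  proof -
    show "0 \<le> s a b" unfolding s_def by (rule sum_nonneg) auto
    have "0 \<le> n a b - s a b" unfolding n_s by (rule sum_nonneg) auto
    then show "s a b \<le> n a b" by simp
  qed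
  have pos: "0 < s a b" if "(i, j) \<in> B a b" "A i j" for a b i j
    unfolding s_def by (rule sum_pos2[OF _ that(1)]) (use that in auto)
  have neg: "s a b < n a b" if "(i, j) \<in> B a b" "\<not> A i j" for a b i j
  proof -
    have "0 < n a b - s a b"
      unfolding n_s by (rule sum_pos2[OF _ that(1)]) (use that in auto)
    then show ?thesis by simp
  qed
  have term_le: "t \<theta> p \<le> t h p + ereal (case p of (i, j) \<Rightarrow> c (A i j) (z i) (z j))"
    if "p \<in> node_pairs N" for p
  proof -
    obtain i j where p: "p = (i, j)" by (cases p)
    let ?a = "z i" and ?b = "z j"
    have B: "(i, j) \<in> B ?a ?b" using that p by (auto simp: B_def)
    have "i \<in> {1..N}" "j \<in> {1..N}" using that p by (auto simp: node_pairs_def)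
    then have "?a \<in> {1..K}" "?b \<in> {1..K}" using z by (auto simp: assignments_def PiE_iff)
    then have th: "0 \<le> \<theta> ?a ?b" "\<theta> ?a ?b \<le> 1" using range[of ?a ?b] by auto
    show ?thesis
    proof (cases "A i j")
      case True
      then have hp: "0 < h ?a ?b"
        using pos[OF B] s_nonneg[of ?a ?b] by (simp add: h_eq)
      have "ln (\<theta> ?a ?b) \<le> ln (h ?a ?b) + (\<theta> ?a ?b / h ?a ?b - 1)" if "\<theta> ?a ?b \<noteq> 0"
        using ln_le_minus_one[of "\<theta> ?a ?b / h ?a ?b"] th that hp
        by (simp add: ln_div)
      then show ?thesis
        using True hp by (auto simp: p t_def ln_term_def c_def)
    next
      case False
      then have hp: "h ?a ?b < 1"
        using neg[OF B] s_nonneg[of ?a ?b] by (simp add: h_eq divide_less_eq)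
      have "ln (1 - \<theta> ?a ?b) \<le> ln (1 - h ?a ?b) + ((1 - \<theta> ?a ?b) / (1 - h ?a ?b) - 1)"
        if "\<theta> ?a ?b \<noteq> 1"
        using ln_le_minus_one[of "(1 - \<theta> ?a ?b) / (1 - h ?a ?b)"] th that hp
        by (simp add: ln_div)
      then show ?thesis
        using False hp by (auto simp: p t_def ln_term_def c_def)
    qed
  qed
  have block: "(\<Sum>(i, j)\<in>B a b. c (A i j) (z i) (z j)) \<le> 0"
    if ab: "(a, b) \<in> class_pairs K" for a b
  proof -
    have K: "a \<in> {1..K}" "b \<in> {1..K}" using ab by (auto simp: class_pairs_def)
    have th: "0 \<le> \<theta> a b" "\<theta> a b \<le> 1" using range[OF K] by auto
    have comm: "h b a = h a b" by (simp add: h_def theta_hat_def block_mean_commute)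
    have "(\<Sum>(i, j)\<in>B a b. c (A i j) (z i) (z j))
        = (\<Sum>(i, j)\<in>B a b. of_bool (A i j) * (\<theta> a b / h a b - 1)
            + of_bool (\<not> A i j) * ((1 - \<theta> a b) / (1 - h a b) - 1))"
    proof (rule sum.cong[OF refl], clarify)
      fix i j assume "(i, j) \<in> B a b"
      then have "z i = a \<and> z j = b \<or> z i = b \<and> z j = a"
        by (auto simp: B_def doubleton_eq_iff)
      then have "c (A i j) (z i) (z j) = c (A i j) a b"
        using comm sym[OF K] by (auto simp: c_def)
      then show "c (A i j) (z i) (z j) = of_bool (A i j) * (\<theta> a b / h a b - 1)
            + of_bool (\<not> A i j) * ((1 - \<theta> a b) / (1 - h a b) - 1)"
        by (simp add: c_def)
    qed
    also have "\<dots> = s a b * (\<theta> a b / h a b - 1)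
        + (n a b - s a b) * ((1 - \<theta> a b) / (1 - h a b) - 1)"
      unfolding n_s by (simp only: s_def sum.distrib sum_distrib_right case_prod_beta')
    also have "\<dots> \<le> 0"
    proof -
      consider "s a b = 0" | "s a b = n a b" | "0 < s a b" "s a b < n a b"
        using s_nonneg[of a b] by linarith
      then show ?thesis
      proof cases
        case 1
        then show ?thesis using th s_nonneg[of a b] by (simp add: h_eq mult_nonneg_nonpos)
      next
        case 2
        then show ?thesis using th s_nonneg[of a b]
          by (cases "n a b = 0") (auto simp: h_eq mult_nonneg_nonpos)
      next
        case 3
        then have "1 - h a b = (n a b - s a b) / n a b" by (simp add: h_eq field_simps)
        with 3 show ?thesis by (simp add: h_eq field_simps)
      qed
    qed
    finally show ?thesis .
  qed
  have "(\<Sum>(i, j)\<in>node_pairs N. c (A i j) (z i) (z j))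
      = (\<Sum>q\<in>class_pairs K. \<Sum>p\<in>{p \<in> node_pairs N.
          (case p of (i, j) \<Rightarrow> (min (z i) (z j), max (z i) (z j))) = q}.
            case p of (i, j) \<Rightarrow> c (A i j) (z i) (z j))"
  proof (rule sum.group[symmetric])
    show "(\<lambda>(i, j). (min (z i) (z j), max (z i) (z j))) ` node_pairs N \<subseteq> class_pairs K"
    proof clarify
      fix i j assume "(i, j) \<in> node_pairs N"
      then have "i \<in> {1..N}" "j \<in> {1..N}" by (auto simp: node_pairs_def)
      then have "z i \<in> {1..K}" "z j \<in> {1..K}" using z by (auto simp: assignments_def PiE_iff)
      then show "(min (z i) (z j), max (z i) (z j)) \<in> class_pairs K"
        by (auto simp: class_pairs_def)
    qed
  qed auto
  also have "\<dots> = (\<Sum>(a, b)\<in>class_pairs K. \<Sum>(i, j)\<in>B a b. c (A i j) (z i) (z j))"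
    by (intro sum.cong refl)
      (auto simp: B_def class_pairs_def min_def max_def doubleton_eq_iff intro!: sum.cong split: if_splits)
  also have "\<dots> \<le> 0"
    by (rule sum_nonpos) (use block in auto)
  finally have c: "(\<Sum>(i, j)\<in>node_pairs N. c (A i j) (z i) (z j)) \<le> 0" .
  have "log_likelihood N A z \<theta> = sum (t \<theta>) (node_pairs N)"
    by (simp add: log_likelihood_def t_def)
  also have "\<dots> \<le> (\<Sum>p\<in>node_pairs N. t h p + ereal (case p of (i, j) \<Rightarrow> c (A i j) (z i) (z j)))"
    by (rule sum_mono) (rule term_le)
  also have "\<dots> = sum (t h) (node_pairs N)
      + ereal (\<Sum>(i, j)\<in>node_pairs N. c (A i j) (z i) (z j))"
    by (simp add: sum.distrib)
  also have "\<dots> \<le> sum (t h) (node_pairs N) + 0"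
    by (rule add_left_mono) (use c in simp)
  also have "\<dots> = log_likelihood N A z (theta_hat N A z)"
    by (simp add: log_likelihood_def t_def h_def)
  finally show ?thesis .
qed

end

theory Submission
  imports Defs
begin

text \<open>
  Fix an assignment \<open>z\<close> and a possible vector \<open>s\<close> of block edge counts, with \<open>h\<^sub>c = s\<^sub>c / n\<^sub>c\<close> the resulting
  proportion in block \<open>c\<close>. Multiply over all pairs of nodes the likelihood ratios of
  \<open>Bernoulli(h\<^sub>c)\<close> against \<open>Bernoulli(q\<^sub>c)\<close>, where \<open>q\<^sub>c\<close> is the average of \<open>P\<close> over the block \<open>c\<close> of
  the pair. This product has two properties.

  Its expectation is at most \<open>1\<close>: by independence it is a product over pairs of terms that are
  affine in \<open>P i j\<close>, by the inequality of arithmetic and geometric means each block contributes at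
  most the \<open>n\<^sub>c\<close>-th power of the same term with \<open>P i j\<close> replaced by \<open>q\<^sub>c\<close>, and that term is at most
  \<open>1\<close> (\<open>expectation_tilt_le_1\<close>).

  If the observed counts are \<open>s\<close>, then it equals the exponential of the divergence sum for \<open>z\<close>
  (\<open>block_divergence_eq_ln_tilt\<close>). This holds almost surely rather than always, since the divergence
  may be infinite when an edge of probability \<open>0\<close> is present or one of probability \<open>1\<close> is absent.

  Hence the sum of these products over all \<open>z\<close> and \<open>s\<close> dominates the exponential of every divergence
  sum, and its expectation is at most the number of pairs \<open>(z, s)\<close>. There are \<open>K ^ N\<close> assignments, and
  for each of them at most \<open>(N / K + 1) ^ (K * (K + 1))\<close> count vectors
  (\<open>card_count_vectors_le\<close>). Markov's inequality for this single sum gives the claim, including the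
  union bound over \<open>z\<close>.
\<close>

section \<open>Blocks\<close>

text \<open>The two classes of a pair of nodes under \<open>z\<close>, the smaller one first, and the block of all pairs
  of nodes with given classes. Ordering the classes makes \<open>class_pairs\<close> the index set of a partition
  of \<open>node_pairs\<close> into blocks.\<close>

definition pair_class :: "(nat \<Rightarrow> nat) \<Rightarrow> nat \<times> nat \<Rightarrow> nat \<times> nat" where
  "pair_class z e = (min (z (fst e)) (z (snd e)), max (z (fst e)) (z (snd e)))"

definition block :: "nat \<Rightarrow> (nat \<Rightarrow> nat) \<Rightarrow> nat \<times> nat \<Rightarrow> (nat \<times> nat) set" where
  "block N z c = {e \<in> node_pairs N. pair_class z e = c}"

lemma finite_block [simp]: "finite (block N z c)"
  by (simp add: block_def)

lemma block_eq:
  assumes "a \<le> b"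
  shows "block N z (a, b) = {(i, j) \<in> node_pairs N. {z i, z j} = {a, b}}"
  using assms by (auto simp: block_def pair_class_def doubleton_eq_iff min_def max_def split: if_splits)

lemma card_block_eq_block_size: "a \<le> b \<Longrightarrow> card (block N z (a, b)) = block_size N z a b"
  by (simp add: block_eq card_block)

lemma block_mean_eq:
  assumes "a \<le> b"
  shows "block_mean N z W a b = (\<Sum>(i, j)\<in>block N z (a, b). W i j) / real (card (block N z (a, b)))"
proof -
  have "(\<Sum>(i, j)\<in>node_pairs N. W i j * of_bool ({z i, z j} = {a, b}))
      = (\<Sum>(i, j)\<in>block N z (a, b). W i j)"
    unfolding block_eq[OF assms] by (rule sum.mono_neutral_cong_right) auto
  then show ?thesis
    by (simp add: block_mean_def card_block_eq_block_size[OF assms])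
qed

lemma pair_class_in_class_pairs:
  assumes "z \<in> assignments N K" "e \<in> node_pairs N"
  shows "pair_class z e \<in> class_pairs K"
proof -
  have "fst e \<in> {1..N}" "snd e \<in> {1..N}" using assms(2) by (auto simp: node_pairs_def)
  then have "z (fst e) \<in> {1..K}" "z (snd e) \<in> {1..K}"
    using assms(1) by (auto simp: assignments_def PiE_iff)
  then show ?thesis by (auto simp: pair_class_def class_pairs_def)
qed

lemma prod_node_pairs_eq:
  fixes f :: "nat \<times> nat \<Rightarrow> real"
  assumes "z \<in> assignments N K"
  shows "(\<Prod>e\<in>node_pairs N. f e) = (\<Prod>c\<in>class_pairs K. \<Prod>e\<in>block N z c. f e)"
  unfolding block_def
  by (rule prod.group[symmetric]) (use pair_class_in_class_pairs[OF assms] in auto)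

text \<open>The number of edges of the graph \<open>X\<close> in a block.\<close>

definition edge_count :: "nat \<Rightarrow> (nat \<Rightarrow> nat) \<Rightarrow> (nat \<Rightarrow> nat \<Rightarrow> bool) \<Rightarrow> nat \<times> nat \<Rightarrow> nat" where
  "edge_count N z X c = card {e \<in> block N z c. X (fst e) (snd e)}"

lemma edge_count_le: "edge_count N z X c \<le> card (block N z c)"
  unfolding edge_count_def by (rule card_mono) auto

lemma theta_hat_eq:
  assumes "a \<le> b"
  shows "theta_hat N X z a b = edge_count N z X (a, b) / card (block N z (a, b))"
proof -
  have "(\<Sum>(i, j)\<in>block N z (a, b). of_bool (X i j)) = real (edge_count N z X (a, b))"
    by (simp add: case_prod_beta edge_count_def sum.If_cases of_bool_def Int_def)
  then show ?thesis
    by (simp add: theta_hat_def block_mean_eq[OF assms])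
qed

lemma theta_bar_bounds:
  assumes P: "\<And>i j. (i, j) \<in> node_pairs N \<Longrightarrow> P i j \<in> {0..1}" and "a \<le> b"
  shows "0 \<le> theta_bar N P z a b" "theta_bar N P z a b \<le> 1"
proof -
  let ?S = "\<Sum>(i, j)\<in>block N z (a, b). P i j"
  have B: "0 \<le> P i j" "P i j \<le> 1" if "(i, j) \<in> block N z (a, b)" for i j
    using that P[of i j] by (auto simp: block_def)
  have "0 \<le> ?S" by (rule sum_nonneg) (use B in auto)
  moreover have "?S \<le> card (block N z (a, b))"
    using sum_bounded_above[of "block N z (a, b)" "\<lambda>(i, j). P i j" 1] B by auto
  ultimately show "0 \<le> theta_bar N P z a b" "theta_bar N P z a b \<le> 1"
    unfolding theta_bar_def block_mean_eq[OF assms(2)]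
    by (auto intro: divide_le_eq_1[THEN iffD2] simp: divide_le_eq)
qed

text \<open>A graph that contains no pair of probability \<open>0\<close> and all pairs of probability \<open>1\<close>. The graphs
  with this property carry the whole mass of the model.\<close>

definition compatible :: "nat \<Rightarrow> (nat \<Rightarrow> nat \<Rightarrow> real) \<Rightarrow> (nat \<Rightarrow> nat \<Rightarrow> bool) \<Rightarrow> bool" where
  "compatible N P X \<longleftrightarrow>
     (\<forall>(i, j)\<in>node_pairs N. (P i j = 0 \<longrightarrow> \<not> X i j) \<and> (P i j = 1 \<longrightarrow> X i j))"

lemma compatible_theta:
  assumes P: "\<And>i j. (i, j) \<in> node_pairs N \<Longrightarrow> P i j \<in> {0..1}" and "a \<le> b"
    and X: "compatible N P X"
  shows "theta_bar N P z a b = 0 \<Longrightarrow> theta_hat N X z a b = 0"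
    and "theta_bar N P z a b = 1 \<Longrightarrow> theta_hat N X z a b = 1"
proof -
  let ?B = "block N z (a, b)"
  have B: "0 \<le> P i j" "P i j \<le> 1" "P i j = 0 \<Longrightarrow> \<not> X i j" "P i j = 1 \<Longrightarrow> X i j"
    if "(i, j) \<in> ?B" for i j
    using that P[of i j] X by (auto simp: block_def compatible_def)
  have bar: "theta_bar N P z a b = (\<Sum>(i, j)\<in>?B. P i j) / card ?B"
    by (simp add: theta_bar_def block_mean_eq[OF assms(2)])
  show "theta_hat N X z a b = 0" if "theta_bar N P z a b = 0"
  proof (cases "?B = {}")
    case False
    with that bar have "(\<Sum>(i, j)\<in>?B. P i j) = 0" by auto
    then have "\<forall>e\<in>?B. (case e of (i, j) \<Rightarrow> P i j) = 0"
      by (subst (asm) sum_nonneg_eq_0_iff) (use B in auto)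
    then have "{e \<in> ?B. X (fst e) (snd e)} = {}" using B by fastforce
    then show ?thesis by (simp only: theta_hat_eq[OF assms(2)] edge_count_def) simp
  qed (simp add: theta_hat_eq[OF assms(2)])
  show "theta_hat N X z a b = 1" if 1: "theta_bar N P z a b = 1"
  proof -
    have ne: "card ?B \<noteq> 0" using 1 bar by (auto simp del: card_0_eq)
    with 1 bar have "(\<Sum>(i, j)\<in>?B. P i j) = card ?B" by simp
    then have "(\<Sum>e\<in>?B. 1 - (case e of (i, j) \<Rightarrow> P i j)) = 0"
      by (simp add: sum_subtractf)
    then have "\<forall>e\<in>?B. 1 - (case e of (i, j) \<Rightarrow> P i j) = 0"
      by (subst (asm) sum_nonneg_eq_0_iff) (use B in auto)
    then have "{e \<in> ?B. X (fst e) (snd e)} = ?B" using B by fastforce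
    then show ?thesis using ne by (simp only: theta_hat_eq[OF assms(2)] edge_count_def) simp
  qed
qed

section \<open>Likelihood ratios\<close>

text \<open>The likelihood ratio of \<open>Bernoulli(h)\<close> against \<open>Bernoulli(q)\<close> at the outcome \<open>x\<close>; a ratio with
  denominator \<open>0\<close> has the value \<open>0\<close>.\<close>

definition likelihood_ratio :: "real \<Rightarrow> real \<Rightarrow> bool \<Rightarrow> real" where
  "likelihood_ratio h q x = (if x then h / q else (1 - h) / (1 - q))"

lemma likelihood_ratio_nonneg:
  "h \<in> {0..1} \<Longrightarrow> q \<in> {0..1} \<Longrightarrow> 0 \<le> likelihood_ratio h q x"
  by (auto simp: likelihood_ratio_def)

text \<open>Strict inequality occurs only for \<open>q = 0\<close> or \<open>q = 1\<close>, where an outcome of \<open>Bernoulli(h)\<close> may have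
  probability \<open>0\<close> under \<open>Bernoulli(q)\<close>.\<close>

lemma likelihood_ratio_mean_le_1:
  assumes "h \<in> {0..1}" "q \<in> {0..1}"
  shows "q * likelihood_ratio h q True + (1 - q) * likelihood_ratio h q False \<le> 1"
proof -
  have "q * (h / q) \<le> h" using assms by (cases "q = 0") simp_all
  moreover have "(1 - q) * ((1 - h) / (1 - q)) \<le> 1 - h" using assms by (cases "q = 1") simp_all
  ultimately show ?thesis by (simp add: likelihood_ratio_def)
qed

text \<open>The power with exponent \<open>0\<close> is \<open>1\<close> whatever its base, in agreement with the convention
  \<open>0 ln 0 = 0\<close> of the divergence. The last two assumptions make the divergence finite.\<close>

lemma KL_eq_ln_likelihood_ratio:
  fixes s n :: nat
  assumes s: "s \<le> n" and h: "h = real s / real n" and q: "0 \<le> q" "q \<le> 1"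
    and ac: "q = 0 \<Longrightarrow> h = 0" "q = 1 \<Longrightarrow> h = 1"
  shows "0 < likelihood_ratio h q True ^ s * likelihood_ratio h q False ^ (n - s)" (is "0 < ?L")
    and "ereal (real n) * bernoulli_KL h q
      = ereal (ln (likelihood_ratio h q True ^ s * likelihood_ratio h q False ^ (n - s)))"
proof -
  consider "n = 0" | "n > 0" "s = 0" | "n > 0" "s = n" | "0 < s" "s < n" using s by linarith
  then have "0 < ?L \<and> ereal (real n) * bernoulli_KL h q = ereal (ln ?L)"
  proof cases
    case 1
    then have L1: "?L = 1" using s by simp
    have "ereal (real n) * bernoulli_KL h q = ereal 0"
      unfolding 1 of_nat_0 zero_ereal_def[symmetric] by (rule ereal_zero_mult)
    then show ?thesis by (simp only: L1 ln_one zero_less_one simp_thms)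
  next
    case 2
    then have "h = 0" using h by simp
    moreover from this have "q < 1" using q(2) ac(2) by linarith
    ultimately show ?thesis using 2
      by (simp add: likelihood_ratio_def bernoulli_KL_def ln_ratio_term_def ln_realpow ln_div)
  next
    case 3
    then have "h = 1" using h by simp
    moreover from this have "q > 0" using q(1) ac(1) by linarith
    ultimately show ?thesis using 3
      by (simp add: likelihood_ratio_def bernoulli_KL_def ln_ratio_term_def ln_realpow ln_div)
  next
    case 4
    then have h01: "0 < h" "h < 1" using h by auto
    then have q01: "0 < q" "q < 1" using q ac by linarith+
    have n: "real n * h = real s" "real n * (1 - h) = real (n - s)"
      using 4 h by (auto simp: field_simps of_nat_diff)
    have pos: "0 < h / q" "0 < (1 - h) / (1 - q)" using h01 q01 by auto
    have "ereal (real n) * bernoulli_KL h q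
        = ereal (real n * (h * ln (h / q) + (1 - h) * ln ((1 - h) / (1 - q))))"
      using h01 q01 by (simp add: bernoulli_KL_def ln_ratio_term_def)
    also have "real n * (h * ln (h / q) + (1 - h) * ln ((1 - h) / (1 - q)))
        = (real n * h) * ln (h / q) + (real n * (1 - h)) * ln ((1 - h) / (1 - q))"
      by (simp add: distrib_left mult.assoc)
    also have "\<dots> = ln ?L"
      unfolding n using pos h01 q01 by (simp add: likelihood_ratio_def ln_mult ln_realpow)
    finally show ?thesis using pos by (simp add: likelihood_ratio_def)
  qed
  then show "0 < ?L" "ereal (real n) * bernoulli_KL h q = ereal (ln ?L)" by auto
qed

lemma prod_le_mean_power:
  fixes x :: "'a \<Rightarrow> real"
  assumes "finite S" and nonneg: "\<And>i. i \<in> S \<Longrightarrow> 0 \<le> x i"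
  shows "(\<Prod>i\<in>S. x i) \<le> ((\<Sum>i\<in>S. x i) / card S) ^ card S"
proof (cases "S = {}")
  case False
  let ?n = "card S"
  have n: "?n > 0" using assms(1) False by (simp add: card_gt_0_iff)
  have p: "0 \<le> (\<Prod>i\<in>S. x i)" by (rule prod_nonneg) (use nonneg in auto)
  have "(\<Prod>i\<in>S. x i) = ((\<Prod>i\<in>S. x i) powr (1 / ?n)) ^ ?n"
  proof (cases "(\<Prod>i\<in>S. x i) = 0")
    case True
    then show ?thesis using n by (simp add: power_0_left)
  next
    case False
    then show ?thesis using p n by (simp add: powr_power)
  qed
  also have "\<dots> \<le> ((\<Sum>i\<in>S. x i) / ?n) ^ ?n"
    by (rule power_mono)
      (use arith_geom_mean[OF assms(1) False nonneg] in \<open>auto simp: sum_divide_distrib\<close>)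
  finally show ?thesis .
qed simp

text \<open>The product over all pairs of nodes of the likelihood ratios of \<open>Bernoulli(s\<^sub>c / n\<^sub>c)\<close> against
  \<open>Bernoulli\<close> with the average of \<open>P\<close> over the block \<open>c\<close>, evaluated at the graph \<open>X\<close>.\<close>

definition tilt ::
    "nat \<Rightarrow> (nat \<Rightarrow> nat \<Rightarrow> real) \<Rightarrow> (nat \<Rightarrow> nat) \<Rightarrow> (nat \<times> nat \<Rightarrow> nat) \<Rightarrow> (nat \<Rightarrow> nat \<Rightarrow> bool) \<Rightarrow> real" where
  "tilt N P z s X = (\<Prod>e\<in>node_pairs N. case pair_class z e of (a, b) \<Rightarrow>
     likelihood_ratio (s (a, b) / block_size N z a b) (theta_bar N P z a b) (X (fst e) (snd e)))"

text \<open>The vectors of possible edge counts of all blocks. They are extensional functions, which makes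
  this set finite.\<close>

definition count_vectors :: "nat \<Rightarrow> nat \<Rightarrow> (nat \<Rightarrow> nat) \<Rightarrow> (nat \<times> nat \<Rightarrow> nat) set" where
  "count_vectors N K z = (\<Pi>\<^sub>E (a, b)\<in>class_pairs K. {..block_size N z a b})"

lemma count_vectors_proportion:
  assumes "s \<in> count_vectors N K z" "(a, b) \<in> class_pairs K"
  shows "real (s (a, b)) / real (block_size N z a b) \<in> {0..1}"
proof -
  have "s (a, b) \<le> block_size N z a b"
    using assms by (auto simp: count_vectors_def PiE_iff)
  then show ?thesis by (auto simp: divide_le_eq)
qed

lemma tilt_nonneg:
  assumes P: "\<And>i j. (i, j) \<in> node_pairs N \<Longrightarrow> P i j \<in> {0..1}"
    and z: "z \<in> assignments N K" and s: "s \<in> count_vectors N K z"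
  shows "0 \<le> tilt N P z s X"
  unfolding tilt_def
proof (rule prod_nonneg)
  fix e assume "e \<in> node_pairs N"
  then have c: "pair_class z e \<in> class_pairs K" by (rule pair_class_in_class_pairs[OF z])
  obtain a b where ab: "pair_class z e = (a, b)" by (cases "pair_class z e")
  then have le: "a \<le> b" using c by (simp add: class_pairs_def)
  show "0 \<le> (case pair_class z e of (a, b) \<Rightarrow> likelihood_ratio (s (a, b) / block_size N z a b)
      (theta_bar N P z a b) (X (fst e) (snd e)))"
    unfolding ab case_prod_conv
    by (rule likelihood_ratio_nonneg)
      (use count_vectors_proportion[OF s] theta_bar_bounds[of N P, OF P le] c ab in auto)
qed

lemma block_divergence_eq_ln_tilt:
  assumes P: "\<And>i j. (i, j) \<in> node_pairs N \<Longrightarrow> P i j \<in> {0..1}"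
    and z: "z \<in> assignments N K" and X: "compatible N P X"
    and s: "\<And>c. c \<in> class_pairs K \<Longrightarrow> s c = edge_count N z X c"
  shows "0 < tilt N P z s X"
    and "block_divergence N K P X z = ereal (ln (tilt N P z s X))"
proof -
  define L where "L = (\<lambda>(a, b).
    likelihood_ratio (theta_hat N X z a b) (theta_bar N P z a b) True ^ edge_count N z X (a, b) *
    likelihood_ratio (theta_hat N X z a b) (theta_bar N P z a b) False
      ^ (card (block N z (a, b)) - edge_count N z X (a, b)))"
  have L: "0 < L c" "(case c of (a, b) \<Rightarrow> ereal (real (block_size N z a b))
        * bernoulli_KL (theta_hat N X z a b) (theta_bar N P z a b)) = ereal (ln (L c))"
    if "c \<in> class_pairs K" for c
  proof -
    obtain a b where c: "c = (a, b)" by (cases c)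
    then have le: "a \<le> b" using that by (simp add: class_pairs_def)
    note KL = KL_eq_ln_likelihood_ratio[OF edge_count_le theta_hat_eq[OF le]
        theta_bar_bounds[of N P, OF P le] compatible_theta[of N P, OF P le X]]
    show "0 < L c" "(case c of (a, b) \<Rightarrow> ereal (real (block_size N z a b))
        * bernoulli_KL (theta_hat N X z a b) (theta_bar N P z a b)) = ereal (ln (L c))"
      using KL by (auto simp: L_def c card_block_eq_block_size[OF le])
  qed
  have "tilt N P z s X = (\<Prod>c\<in>class_pairs K. L c)"
    unfolding tilt_def prod_node_pairs_eq[OF z]
  proof (rule prod.cong[OF refl])
    fix c assume c: "c \<in> class_pairs K"
    obtain a b where ab: "c = (a, b)" by (cases c)
    then have le: "a \<le> b" using c by (simp add: class_pairs_def)
    let ?r = "likelihood_ratio (theta_hat N X z a b) (theta_bar N P z a b)"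
    let ?E = "{e \<in> block N z c. X (fst e) (snd e)}"
    have "(\<Prod>e\<in>block N z c. case pair_class z e of (a, b) \<Rightarrow>
        likelihood_ratio (s (a, b) / block_size N z a b) (theta_bar N P z a b) (X (fst e) (snd e)))
      = (\<Prod>e\<in>block N z c. if e \<in> ?E then ?r True else ?r False)"
    proof (rule prod.cong[OF refl])
      fix e assume e: "e \<in> block N z c"
      then have "pair_class z e = (a, b)" using ab by (simp add: block_def)
      then show "(case pair_class z e of (a, b) \<Rightarrow>
          likelihood_ratio (s (a, b) / block_size N z a b) (theta_bar N P z a b) (X (fst e) (snd e)))
        = (if e \<in> ?E then ?r True else ?r False)"
        using e s[OF c] ab
        by (auto simp: theta_hat_eq[OF le] card_block_eq_block_size[OF le] split: prod.splits)
    qed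
    also have "\<dots> = ?r True ^ card ?E * ?r False ^ card (block N z c - ?E)"
    proof -
      have "block N z c \<inter> {e. e \<in> ?E} = ?E" "block N z c \<inter> - {e. e \<in> ?E} = block N z c - ?E"
        by auto
      then show ?thesis by (subst prod.If_cases) (simp_all only: finite_block prod_constant)
    qed
    also have "card (block N z c - ?E) = card (block N z c) - card ?E"
      by (rule card_Diff_subset) (auto intro: finite_subset[OF _ finite_block[of N z c]])
    finally show "(\<Prod>e\<in>block N z c. case pair_class z e of (a, b) \<Rightarrow>
        likelihood_ratio (s (a, b) / block_size N z a b) (theta_bar N P z a b) (X (fst e) (snd e)))
      = L c"
      by (simp add: L_def ab edge_count_def)
  qed
  moreover have "0 < (\<Prod>c\<in>class_pairs K. L c)"
    by (rule prod_pos) (use L in auto)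
  moreover have "block_divergence N K P X z = (\<Sum>c\<in>class_pairs K. ereal (ln (L c)))"
    unfolding block_divergence_def by (rule sum.cong[OF refl]) (use L(2) in blast)
  moreover have "(\<Sum>c\<in>class_pairs K. ln (L c)) = ln (\<Prod>c\<in>class_pairs K. L c)"
    by (rule ln_prod[symmetric]) (use L in \<open>auto simp: less_imp_neq[symmetric]\<close>)
  ultimately show "0 < tilt N P z s X"
    and "block_divergence N K P X z = ereal (ln (tilt N P z s X))"
    by simp_all
qed

section \<open>Counting\<close>

lemma sum_class_size:
  assumes "z \<in> assignments N K"
  shows "(\<Sum>a\<in>{1..K}. class_size N z a) = N"
proof -
  have "(\<Sum>a\<in>{1..K}. \<Sum>i\<in>{i \<in> {1..N}. z i = a}. 1) = (\<Sum>i\<in>{1..N}. 1 :: nat)"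
    by (rule sum.group) (use assms in \<open>auto simp: assignments_def PiE_iff\<close>)
  then show ?thesis by (simp add: class_size_def)
qed

text \<open>Every class occurs \<open>K + 1\<close> times as a component of an element of \<open>class_pairs K\<close>: once with each
  other class, and twice in the diagonal pair.\<close>

lemma prod_class_pairs:
  fixes f :: "nat \<Rightarrow> real"
  shows "(\<Prod>(a, b)\<in>class_pairs K. f a * f b) = (\<Prod>a\<in>{1..K}. f a) ^ (K + 1)"
proof (induction K)
  case 0
  have "class_pairs 0 = {}" by (auto simp: class_pairs_def)
  then show ?case by simp
next
  case (Suc K)
  have cp: "class_pairs (Suc K) = class_pairs K \<union> (\<lambda>a. (a, Suc K)) ` {1..Suc K}"
    by (auto simp: class_pairs_def le_Suc_eq)
  have "(\<Prod>(a, b)\<in>class_pairs (Suc K). f a * f b)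
      = (\<Prod>(a, b)\<in>class_pairs K. f a * f b) * (\<Prod>(a, b)\<in>(\<lambda>a. (a, Suc K)) ` {1..Suc K}. f a * f b)"
    unfolding cp
    by (rule prod.union_disjoint[OF finite_class_pairs]) (auto simp: class_pairs_def)
  also have "(\<Prod>(a, b)\<in>(\<lambda>a. (a, Suc K)) ` {1..Suc K}. f a * f b) = (\<Prod>a\<in>{1..Suc K}. f a * f (Suc K))"
    by (subst prod.reindex) (auto simp: inj_on_def)
  also have "\<dots> = (\<Prod>a\<in>{1..Suc K}. f a) * f (Suc K) ^ Suc K"
    by (simp add: prod.distrib)
  finally show ?case
    by (simp add: Suc.IH power_mult_distrib algebra_simps)
qed

text \<open>A block of classes \<open>a\<close> and \<open>b\<close> has at most \<open>N\<^sub>a N\<^sub>b\<close> pairs, also if \<open>a = b\<close>, so its factor is at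
  most \<open>(N\<^sub>a + 1) (N\<^sub>b + 1)\<close>. The remaining product of the \<open>N\<^sub>a + 1\<close> is largest when all class sizes
  equal \<open>N / K\<close>.\<close>

lemma prod_block_size_le:
  assumes z: "z \<in> assignments N K" and "K \<ge> 1"
  shows "(\<Prod>(a, b)\<in>class_pairs K. real (block_size N z a b) + 1)
    \<le> (real N / real K + 1) ^ (K * (K + 1))"
proof -
  let ?n = "\<lambda>a. real (class_size N z a)"
  have "(\<Prod>(a, b)\<in>class_pairs K. real (block_size N z a b) + 1)
      \<le> (\<Prod>(a, b)\<in>class_pairs K. (?n a + 1) * (?n b + 1))"
  proof (rule prod_mono, clarify)
    fix a b
    have "block_size N z a b \<le> class_size N z a * class_size N z b"
      by (auto simp: block_size_def choose_two intro: order_trans[OF div_le_dividend])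
    then have "real (block_size N z a b) \<le> ?n a * ?n b"
      by (metis of_nat_mult of_nat_le_iff)
    also have "\<dots> + 1 \<le> (?n a + 1) * (?n b + 1)" by (simp add: algebra_simps)
    finally show "0 \<le> real (block_size N z a b) + 1 \<and>
        real (block_size N z a b) + 1 \<le> (?n a + 1) * (?n b + 1)" by simp
  qed
  also have "\<dots> = (\<Prod>a\<in>{1..K}. ?n a + 1) ^ (K + 1)"
    by (rule prod_class_pairs)
  also have "\<dots> \<le> ((real N / real K + 1) ^ K) ^ (K + 1)"
  proof (rule power_mono)
    have "(\<Prod>a\<in>{1..K}. ?n a + 1) \<le> ((\<Sum>a\<in>{1..K}. ?n a + 1) / card {1..K}) ^ card {1..K}"
      by (rule prod_le_mean_power) auto
    also have "(\<Sum>a\<in>{1..K}. ?n a + 1) = real N + real K"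
      using sum_class_size[OF z] by (simp add: sum.distrib flip: of_nat_sum)
    finally show "(\<Prod>a\<in>{1..K}. ?n a + 1) \<le> (real N / real K + 1) ^ K"
      using \<open>K \<ge> 1\<close> by (simp add: add_divide_distrib)
  qed (auto intro: prod_nonneg)
  finally show ?thesis by (simp only: power_mult)
qed

lemma finite_count_vectors [simp]: "finite (count_vectors N K z)"
  unfolding count_vectors_def by (rule finite_PiE) auto

lemma card_count_vectors_le:
  assumes "z \<in> assignments N K" and "K \<ge> 1"
  shows "real (card (count_vectors N K z)) \<le> (real N / real K + 1) ^ (K * (K + 1))"
proof -
  have "real (card (count_vectors N K z)) = (\<Prod>(a, b)\<in>class_pairs K. real (block_size N z a b) + 1)"
    unfolding count_vectors_def by (subst card_PiE) (auto simp: case_prod_beta add.commute)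
  then show ?thesis using prod_block_size_le[OF assms] by simp
qed

lemma edge_count_in_count_vectors:
  "restrict (edge_count N z X) (class_pairs K) \<in> count_vectors N K z"
  using edge_count_le[of N z X]
  by (auto simp: count_vectors_def class_pairs_def simp flip: card_block_eq_block_size)

lemma finite_assignments [simp]: "finite (assignments N K)"
  unfolding assignments_def by (rule finite_PiE) auto

lemma card_assignments: "card (assignments N K) = K ^ N"
  by (simp add: assignments_def card_PiE)

section \<open>The random graph\<close>

lemma (in prob_space) expectation_bool_function:
  fixes f :: "bool \<Rightarrow> real"
  assumes m: "X \<in> measurable M (count_space UNIV)" and "p \<in> {0..1}"
    and d: "distr M (count_space UNIV) X = measure_pmf (bernoulli_pmf p)"
  shows "integrable M (\<lambda>\<omega>. f (X \<omega>))"
    and "(\<integral>\<omega>. f (X \<omega>) \<partial>M) = p * f True + (1 - p) * f False"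
proof -
  show "integrable M (\<lambda>\<omega>. f (X \<omega>))"
  proof (rule integrable_const_bound[where B = "\<bar>f True\<bar> + \<bar>f False\<bar>"])
    have "norm (f x) \<le> \<bar>f True\<bar> + \<bar>f False\<bar>" for x by (cases x) auto
    then show "AE \<omega> in M. norm (f (X \<omega>)) \<le> \<bar>f True\<bar> + \<bar>f False\<bar>" by simp
    show "(\<lambda>\<omega>. f (X \<omega>)) \<in> borel_measurable M" by (rule measurable_compose[OF m]) simp
  qed
  have "(\<integral>\<omega>. f (X \<omega>) \<partial>M) = (\<integral>x. f x \<partial>distr M (count_space UNIV) X)"
    by (rule integral_distr[OF m, symmetric]) simp
  also have "\<dots> = p * f True + (1 - p) * f False"
    using assms(2) by (simp add: d)
  finally show "(\<integral>\<omega>. f (X \<omega>) \<partial>M) = p * f True + (1 - p) * f False" .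
qed

lemma (in prob_space) AE_compatible:
  assumes meas: "\<And>i j. (i, j) \<in> node_pairs N \<Longrightarrow> A i j \<in> measurable M (count_space UNIV)"
    and distr: "\<And>i j. (i, j) \<in> node_pairs N \<Longrightarrow>
           distr M (count_space UNIV) (A i j) = measure_pmf (bernoulli_pmf (P i j))"
  shows "AE \<omega> in M. compatible N P (\<lambda>i j. A i j \<omega>)"
proof -
  have "AE \<omega> in M. (P i j = 0 \<longrightarrow> \<not> A i j \<omega>) \<and> (P i j = 1 \<longrightarrow> A i j \<omega>)"
    if "(i, j) \<in> node_pairs N" for i j
  proof -
    have "(P i j = 0 \<longrightarrow> \<not> x) \<and> (P i j = 1 \<longrightarrow> x)"
      if "x \<in> set_pmf (bernoulli_pmf (P i j))" for x
      using that by (cases x) (auto simp: set_pmf_iff)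
    then have "AE x in distr M (count_space UNIV) (A i j).
        (P i j = 0 \<longrightarrow> \<not> x) \<and> (P i j = 1 \<longrightarrow> x)"
      unfolding distr[OF that] AE_measure_pmf_iff by blast
    then show ?thesis
      by (subst (asm) AE_distr_iff[OF meas[OF that]]) auto
  qed
  then have "AE \<omega> in M. \<forall>e\<in>node_pairs N. (P (fst e) (snd e) = 0 \<longrightarrow> \<not> A (fst e) (snd e) \<omega>)
      \<and> (P (fst e) (snd e) = 1 \<longrightarrow> A (fst e) (snd e) \<omega>)"
    by (subst AE_finite_all) auto
  then show ?thesis by (simp add: compatible_def case_prod_beta)
qed

lemma (in prob_space) expectation_tilt_le_1:
  assumes P: "\<And>i j. (i, j) \<in> node_pairs N \<Longrightarrow> P i j \<in> {0..1}"
    and indep: "indep_vars (\<lambda>_. count_space UNIV) (\<lambda>(i, j). A i j) (node_pairs N)"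
    and distr: "\<And>i j. (i, j) \<in> node_pairs N \<Longrightarrow>
           distr M (count_space UNIV) (A i j) = measure_pmf (bernoulli_pmf (P i j))"
    and z: "z \<in> assignments N K" and s: "s \<in> count_vectors N K z"
  shows "integrable M (\<lambda>\<omega>. tilt N P z s (\<lambda>i j. A i j \<omega>))"
    and "(\<integral>\<omega>. tilt N P z s (\<lambda>i j. A i j \<omega>) \<partial>M) \<le> 1"
proof -
  have meas: "A i j \<in> measurable M (count_space UNIV)" if "(i, j) \<in> node_pairs N" for i j
    using indep that by (auto simp: indep_vars_def)
  define r where "r c = (case c of (a, b) \<Rightarrow>
    likelihood_ratio (s (a, b) / block_size N z a b) (theta_bar N P z a b))" for c
  have tilt: "tilt N P z s (\<lambda>i j. A i j \<omega>)
      = (\<Prod>e\<in>node_pairs N. r (pair_class z e) ((case e of (i, j) \<Rightarrow> A i j) \<omega>))" for \<omega>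
    unfolding tilt_def by (intro prod.cong refl) (auto simp: r_def split: prod.splits)
  have ind: "indep_vars (\<lambda>_. borel) (\<lambda>e \<omega>. r (pair_class z e) ((case e of (i, j) \<Rightarrow> A i j) \<omega>))
      (node_pairs N)"
    by (rule indep_vars_compose2[OF indep]) simp
  have int: "integrable M (\<lambda>\<omega>. r (pair_class z e) ((case e of (i, j) \<Rightarrow> A i j) \<omega>))"
    and ex: "(\<integral>\<omega>. r (pair_class z e) ((case e of (i, j) \<Rightarrow> A i j) \<omega>) \<partial>M)
      = P (fst e) (snd e) * r (pair_class z e) True + (1 - P (fst e) (snd e)) * r (pair_class z e) False"
    if "e \<in> node_pairs N" for e
    using that expectation_bool_function[OF meas P distr, of "fst e" "snd e"]
    by (auto simp: case_prod_beta)
  show "integrable M (\<lambda>\<omega>. tilt N P z s (\<lambda>i j. A i j \<omega>))"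
    unfolding tilt by (rule indep_vars_integrable[OF _ ind int]) auto
  have "(\<integral>\<omega>. tilt N P z s (\<lambda>i j. A i j \<omega>) \<partial>M)
      = (\<Prod>e\<in>node_pairs N. \<integral>\<omega>. r (pair_class z e) ((case e of (i, j) \<Rightarrow> A i j) \<omega>) \<partial>M)"
    unfolding tilt by (rule indep_vars_lebesgue_integral[OF _ ind int]) auto
  also have "\<dots> = (\<Prod>e\<in>node_pairs N. P (fst e) (snd e) * r (pair_class z e) True
      + (1 - P (fst e) (snd e)) * r (pair_class z e) False)"
    by (rule prod.cong) (use ex in auto)
  also have "\<dots> = (\<Prod>c\<in>class_pairs K. \<Prod>e\<in>block N z c. P (fst e) (snd e) * r c True
      + (1 - P (fst e) (snd e)) * r c False)"
    unfolding prod_node_pairs_eq[OF z] by (intro prod.cong refl) (auto simp: block_def)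
  also have "\<dots> \<le> 1"
  proof (rule prod_le_1)
    fix c assume c: "c \<in> class_pairs K"
    obtain a b where ab: "c = (a, b)" by (cases c)
    then have le: "a \<le> b" using c by (simp add: class_pairs_def)
    let ?q = "theta_bar N P z a b" and ?n = "card (block N z c)"
    have h01: "real (s (a, b)) / real (block_size N z a b) \<in> {0..1}"
      using count_vectors_proportion[OF s] c ab by auto
    have q01: "?q \<in> {0..1}" using theta_bar_bounds[of N P, OF P le] by auto
    have r: "0 \<le> r c x" for x
      unfolding r_def ab case_prod_conv by (rule likelihood_ratio_nonneg[OF h01 q01])
    have mean: "?q * r c True + (1 - ?q) * r c False \<le> 1"
      unfolding r_def ab case_prod_conv by (rule likelihood_ratio_mean_le_1[OF h01 q01])
    \<comment> \<open>The sum over the block is affine in \<open>P\<close>, so only the block average of \<open>P\<close> matters.\<close>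
    let ?f = "\<lambda>e. P (fst e) (snd e) * r c True + (1 - P (fst e) (snd e)) * r c False"
    have f: "0 \<le> ?f e" if "e \<in> block N z c" for e
      using that P[of "fst e" "snd e"] r by (auto simp: block_def)
    have "(\<Prod>e\<in>block N z c. ?f e) \<le> ((\<Sum>e\<in>block N z c. ?f e) / ?n) ^ ?n"
      by (rule prod_le_mean_power) (use f in auto)
    also have "\<dots> \<le> 1"
    proof (cases "?n = 0")
      case False
      have "(\<Sum>e\<in>block N z c. P (fst e) (snd e)) = ?n * ?q"
        using False unfolding theta_bar_def block_mean_eq[OF le] by (simp add: ab case_prod_beta)
      then have "(\<Sum>e\<in>block N z c. ?f e) = ?n * (?q * r c True + (1 - ?q) * r c False)"
        by (simp add: sum.distrib sum_subtractf algebra_simps flip: sum_distrib_left sum_distrib_right)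
      then have "(\<Sum>e\<in>block N z c. ?f e) / ?n \<le> 1"
        using mean False by simp
      then show ?thesis
        by (intro power_le_one divide_nonneg_nonneg sum_nonneg) (use f in auto)
    qed simp
    finally show "0 \<le> (\<Prod>e\<in>block N z c. ?f e) \<and> (\<Prod>e\<in>block N z c. ?f e) \<le> 1"
      using f by (auto intro: prod_nonneg)
  qed
  finally show "(\<integral>\<omega>. tilt N P z s (\<lambda>i j. A i j \<omega>) \<partial>M) \<le> 1" .
qed

lemma borel_measurable_bernoulli_KL [measurable]: "(\<lambda>p. bernoulli_KL p q) \<in> borel_measurable borel"
  unfolding bernoulli_KL_def ln_ratio_term_def by measurable

lemma borel_measurable_block_divergence:
  assumes meas: "\<And>i j. (i, j) \<in> node_pairs N \<Longrightarrow> A i j \<in> measurable M (count_space UNIV)"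
  shows "(\<lambda>\<omega>. block_divergence N K P (\<lambda>i j. A i j \<omega>) z) \<in> borel_measurable M"
proof -
  have "(\<lambda>\<omega>. of_bool (A (fst e) (snd e) \<omega>) :: real) \<in> borel_measurable M" if "e \<in> node_pairs N" for e
    by (rule measurable_compose[OF meas]) (use that in auto)
  then have [measurable]: "(\<lambda>\<omega>. theta_hat N (\<lambda>i j. A i j \<omega>) z a b) \<in> borel_measurable M" for a b
    unfolding theta_hat_def block_mean_def case_prod_beta
    by (intro borel_measurable_divide borel_measurable_sum borel_measurable_times) auto
  show ?thesis
    unfolding block_divergence_def case_prod_beta by measurable
qed

theorem theorem1:
  fixes N K :: nat
    and M :: "'w measure"
    and A :: "nat \<Rightarrow> nat \<Rightarrow> 'w \<Rightarrow> bool"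
    and P :: "nat \<Rightarrow> nat \<Rightarrow> real"
    and \<delta> :: real
  assumes "N \<ge> 2" and "K \<ge> 1"
    and "prob_space M"
    and "\<And>i j. (i, j) \<in> node_pairs N \<Longrightarrow> P i j \<in> {0..1}"
    and "prob_space.indep_vars M (\<lambda>_. count_space UNIV) (\<lambda>(i, j). A i j) (node_pairs N)"
    and "\<And>i j. (i, j) \<in> node_pairs N \<Longrightarrow>
           distr M (count_space UNIV) (A i j) = measure_pmf (bernoulli_pmf (P i j))"
    and "0 < \<delta>" and "\<delta> < 1"
  shows "measure M {\<omega> \<in> space M.
           (MAX z\<in>assignments N K. block_divergence N K P (\<lambda>i j. A i j \<omega>) z)
             < ereal (real N * ln (real K)
                 + (real K ^ 2 + real K) * ln (real N / real K + 1) + ln (1 / \<delta>))}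
         \<ge> 1 - \<delta>"
proof -
  note P = assms(4) and indep = assms(5) and distr = assms(6)
  interpret prob_space M by fact
  have meas: "A i j \<in> measurable M (count_space UNIV)" if "(i, j) \<in> node_pairs N" for i j
    using indep that by (auto simp: indep_vars_def)
  define C where "C = real K ^ N * (real N / real K + 1) ^ (K * (K + 1))"
  have K: "real K > 0" and C: "C > 0"
    using \<open>K \<ge> 1\<close> by (auto simp: C_def intro!: mult_pos_pos zero_less_power add_nonneg_pos)
  have lnC: "ln (C / \<delta>) = real N * ln (real K)
      + (real K ^ 2 + real K) * ln (real N / real K + 1) + ln (1 / \<delta>)"
  proof -
    have pos: "real N / real K + 1 > 0" by (simp add: add_nonneg_pos)
    have "ln C = real N * ln (real K) + real (K * (K + 1)) * ln (real N / real K + 1)"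
      unfolding C_def using K pos by (subst ln_mult) (simp_all add: ln_realpow)
    moreover have "ln (C / \<delta>) = ln C + ln (1 / \<delta>)"
      using C \<open>0 < \<delta>\<close> by (simp add: ln_div)
    ultimately show ?thesis by (simp add: power2_eq_square algebra_simps)
  qed
  let ?T = "\<lambda>z s \<omega>. tilt N P z s (\<lambda>i j. A i j \<omega>)"
  \<comment> \<open>One nonnegative variable that dominates, almost surely, the exponential of every divergence
    sum; its expectation is at most the bound \<open>C\<close> on the number of its summands.\<close>
  define Y where "Y \<omega> = (\<Sum>z\<in>assignments N K. \<Sum>s\<in>count_vectors N K z. ?T z s \<omega>)" for \<omega>
  have nonneg: "0 \<le> ?T z s \<omega>" if "z \<in> assignments N K" "s \<in> count_vectors N K z" for z s \<omega>
    using tilt_nonneg[of N P, OF P that] .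
  note T = expectation_tilt_le_1[of N P A, OF P indep distr]
  have Y_nonneg: "0 \<le> Y \<omega>" for \<omega>
    unfolding Y_def by (intro sum_nonneg nonneg)
  have Y_int: "integrable M Y"
    unfolding Y_def by (intro Bochner_Integration.integrable_sum T(1))
  have "(\<integral>\<omega>. Y \<omega> \<partial>M) = (\<Sum>z\<in>assignments N K. \<Sum>s\<in>count_vectors N K z. \<integral>\<omega>. ?T z s \<omega> \<partial>M)"
    unfolding Y_def using T(1)
    by (subst Bochner_Integration.integral_sum)
      (auto intro!: sum.cong Bochner_Integration.integral_sum Bochner_Integration.integrable_sum)
  also have "\<dots> \<le> (\<Sum>z\<in>assignments N K. \<Sum>s\<in>count_vectors N K z. 1)"
    by (intro sum_mono T(2))
  also have "\<dots> \<le> (\<Sum>z\<in>assignments N K. (real N / real K + 1) ^ (K * (K + 1)))"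
    using card_count_vectors_le[OF _ \<open>K \<ge> 1\<close>] by (intro sum_mono) simp
  also have "\<dots> = C" by (simp add: card_assignments C_def)
  finally have Y_le: "(\<integral>\<omega>. Y \<omega> \<partial>M) \<le> C" .
  \<comment> \<open>The set in the second premise does not occur in the conclusion of Markov's inequality.\<close>
  have "measure M {\<omega> \<in> space M. C / \<delta> \<le> Y \<omega>} \<le> (\<integral>\<omega>. Y \<omega> \<partial>M) / (C / \<delta>)"
    by (rule integral_Markov_inequality_measure[OF Y_int sets.empty_sets])
      (use Y_nonneg C \<open>0 < \<delta>\<close> in auto)
  also have "\<dots> \<le> \<delta>"
    using Y_le C \<open>0 < \<delta>\<close> by (simp add: field_simps)
  finally have markov: "measure M {\<omega> \<in> space M. C / \<delta> \<le> Y \<omega>} \<le> \<delta>" .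
  have [measurable]: "Y \<in> borel_measurable M" using Y_int by simp
  let ?D = "\<lambda>\<omega> z. block_divergence N K P (\<lambda>i j. A i j \<omega>) z"
  let ?E = "{\<omega> \<in> space M. (MAX z\<in>assignments N K. ?D \<omega> z) < ereal (ln (C / \<delta>))}"
  have "assignments N K \<noteq> {}"
    using card_assignments[of N K] K by auto
  then have E: "?E = {\<omega> \<in> space M. \<forall>z\<in>assignments N K. ?D \<omega> z < ereal (ln (C / \<delta>))}"
    by (subst Max_less_iff) auto
  have [measurable]: "(\<lambda>\<omega>. ?D \<omega> z) \<in> borel_measurable M" for z
    by (rule borel_measurable_block_divergence[of N A, OF meas])
  have E_sets: "?E \<in> sets M" unfolding E by measurable
  have bound: "\<omega> \<in> ?E"
    if "\<omega> \<in> space M" "compatible N P (\<lambda>i j. A i j \<omega>)" "Y \<omega> < C / \<delta>" for \<omega>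
    unfolding E
  proof (intro CollectI conjI ballI)
    fix z assume z: "z \<in> assignments N K"
    let ?s = "restrict (edge_count N z (\<lambda>i j. A i j \<omega>)) (class_pairs K)"
    have s: "?s \<in> count_vectors N K z" by (rule edge_count_in_count_vectors)
    note D = block_divergence_eq_ln_tilt[of N P z K _ ?s, OF P z that(2)]
    have "?T z ?s \<omega> \<le> (\<Sum>s\<in>count_vectors N K z. ?T z s \<omega>)"
      by (rule member_le_sum[OF s]) (use nonneg z in auto)
    also have "\<dots> \<le> Y \<omega>"
      unfolding Y_def by (rule member_le_sum[OF z]) (use nonneg in \<open>auto intro: sum_nonneg\<close>)
    also note that(3)
    finally show "?D \<omega> z < ereal (ln (C / \<delta>))"
      using D C \<open>0 < \<delta>\<close> by simp
  qed (fact that)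
  have compat: "AE \<omega> in M. compatible N P (\<lambda>i j. A i j \<omega>)"
    by (rule AE_compatible) (use meas distr in auto)
  have "1 - \<delta> \<le> 1 - measure M {\<omega> \<in> space M. C / \<delta> \<le> Y \<omega>}" using markov by simp
  also have "\<dots> = measure M (space M - {\<omega> \<in> space M. C / \<delta> \<le> Y \<omega>})"
    by (rule prob_compl[symmetric]) measurable
  also have "\<dots> \<le> measure M ?E"
  proof (rule finite_measure_mono_AE[OF _ E_sets])
    show "AE \<omega> in M. \<omega> \<in> space M - {\<omega> \<in> space M. C / \<delta> \<le> Y \<omega>} \<longrightarrow> \<omega> \<in> ?E"
      using compat by eventually_elim (use bound in auto)
  qed
  finally show ?thesis unfolding lnC .
qed

end
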